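(* For every positive integer $k$, $$\sum_{j=0}^{2k}(-1)^j\,\frac{S_3\big(2(j+k),j\big)}{2^{j+k}\,(j+k)!}=\sum_{j=0}^{2k}(-1)^j\,\frac{d_3\big(2(j+k),j\big)}{2^{j+k}\,(j+k)!}.$$
   Context: For integers $n,k\ge 0$, $S_3(n,k)$ (the 3-associated Stirling number of the second kind) is the number of partitions of a set of $n$ elements into $k$ blocks, all with at least $3$ elements, with $S_3(0,0)=1$. For integers $n,l\ge 0$, $d_3(n,l)$ is the number of permutations of a set of $n$ elements that have exactly $l$ cycles, all of length at least $3$ (with $d_3(0,0)=1$). *)

theory Defs
  imports Complex_Main "HOL-Library.Disjoint_Sets" "HOL-Combinatorics.Combinatorics"
begin

definition S3 :: "nat \<Rightarrow> nat \<Rightarrow> nat" where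
  "S3 n k = card {P. partition_on {..<n} P \<and> card P = k \<and> (\<forall>B\<in>P. 3 \<le> card B)}"

text \<open>The cycles of a permutation \<open>p\<close> of \<open>A\<close>, each given by its support:
  these are the orbits of the elements of \<open>A\<close>, where a fixed point \<open>x\<close> has orbit \<open>{x}\<close>
  and so counts as a cycle of length 1.\<close>

definition perm_cycles :: "'a set \<Rightarrow> ('a \<Rightarrow> 'a) \<Rightarrow> 'a set set" where
  "perm_cycles A p = orbit p ` A"

definition d3 :: "nat \<Rightarrow> nat \<Rightarrow> nat" where
  "d3 n l = card {p. p permutes {..<n} \<and> card (perm_cycles {..<n} p) = l \<and>
                     (\<forall>C\<in>perm_cycles {..<n} p. 3 \<le> card C)}"

end

theory Submission
  imports Defs "HOL-Computational_Algebra.Formal_Power_Series"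
begin

unbundle fps_syntax

text \<open>
  Write \<open>f(x) = exp x - 1 - x\<close> and \<open>g(y) = - ln (1 - y) - y\<close>; both have leading term \<open>x\<^sup>2/2\<close>.
  The exponential generating functions of the two arrays are powers of what remains after that
  term: \<open>\<Sum>n. S3 n j x^n/n! = (f(x) - x\<^sup>2/2)^j / j!\<close>, and likewise for \<open>d3\<close> and \<open>g\<close>
  (\<open>S3_egf\<close>, \<open>d3_egf\<close>).

  Up to a factor that depends on \<open>k\<close> only, \<open>(-1)^j (2(j+k))! / (2^(j+k) (j+k)! j! 2^j)\<close> is the binomial coefficient
  of \<open>-k - 1/2\<close> over \<open>j\<close>. Hence each side of the identity is a binomial series: it equals
  \<open>(2k)!/(2^k k!)\<close> times the coefficient of \<open>x^(2k)\<close> in \<open>F^(-k-1/2)\<close>, with \<open>F = 2 f(x)/x\<^sup>2\<close>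
  on the left and \<open>F = 2 g(y)/y\<^sup>2\<close> on the right (\<open>alternating_sum_eq_coeff\<close>). In other words, the
  two sides are the residues of \<open>f^(-k-1/2) dx\<close> and \<open>g^(-k-1/2) dy\<close>, up to a constant.

  The substitution \<open>y = 1 - exp x\<close> turns \<open>g(y)\<close> into \<open>f(x)\<close> and \<open>dy\<close> into \<open>- exp x dx\<close>; the sign
  is absorbed by the choice of the square root. So the two residues differ by that of
  \<open>(exp x - 1) f(x)^(-k-1/2) dx\<close>, which is zero because \<open>exp x - 1\<close> is the derivative of \<open>f\<close>
  (\<open>coeff_exp_eq_coeff_log\<close>).

  Residues are expressed as coefficients of power series: the square root of \<open>2 f\<close> is \<open>x s\<close>, where
  \<open>s = sqrt F\<close> has constant term 1, so the residue of \<open>H(x) (2 f)^(-k-1/2) dx\<close> is the coefficient of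
  \<open>x^(2k)\<close> in \<open>H s^(-2k-1)\<close>.
\<close>

section \<open>Exponential generating functions from a recursion on blocks\<close>

lemma sum_subsets_containing:
  fixes f :: "nat \<Rightarrow> 'b :: comm_semiring_1"
  assumes "finite A" "x \<in> A" "card A = Suc n"
  shows "(\<Sum>B | x \<in> B \<and> B \<subseteq> A. f (card B)) = (\<Sum>i=0..n. of_nat (n choose i) * f (Suc i))"
proof -
  define A' where "A' = A - {x}"
  have A': "finite A'" "card A' = n" "x \<notin> A'" "A = insert x A'"
    using assms by (auto simp: A'_def)
  have "(\<Sum>B | x \<in> B \<and> B \<subseteq> A. f (card B)) = (\<Sum>T\<in>Pow A'. f (Suc (card T)))"
  proof (rule sum.reindex_bij_witness[where i = "insert x" and j = "\<lambda>B. B - {x}"])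
    fix B assume B: "B \<in> {B. x \<in> B \<and> B \<subseteq> A}"
    then have "finite B" using assms(1) finite_subset by blast
    with B show "f (Suc (card (B - {x}))) = f (card B)"
      using card_Suc_Diff1[of B x] by simp
  qed (use A' in auto)
  also have "\<dots> = (\<Sum>i\<in>{0..n}. \<Sum>T\<in>{T \<in> Pow A'. card T = i}. f (Suc (card T)))"
    by (rule sum.group[symmetric]) (use A' card_mono in auto)
  also have "\<dots> = (\<Sum>i=0..n. of_nat (n choose i) * f (Suc i))"
    using A' n_subsets[of A'] by (intro sum.cong refl) (simp add: Pow_def)
  finally show ?thesis .
qed

text \<open>
  Let \<open>W A l\<close> be the total weight of the structures on the finite set \<open>A\<close> that consist of \<open>l\<close>
  blocks, where a block \<open>B\<close> has weight \<open>w (card B)\<close>. Splitting off the block of a chosen element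
  \<open>x\<close> gives the recursion assumed here, and the recursion gives the exponential formula: the
  generating function \<open>E\<close> of \<open>l + 1\<close> blocks satisfies \<open>E' = G' G^l/l!\<close>. The statement ranges over all
  finite sets \<open>A\<close>, so it need not be known beforehand that \<open>W A l\<close> depends on \<open>card A\<close> only.
\<close>

lemma egf_of_block_recursion:
  fixes W :: "'a set \<Rightarrow> nat \<Rightarrow> nat" and w :: "nat \<Rightarrow> nat"
  assumes W_0: "\<And>A. finite A \<Longrightarrow> W A 0 = (if A = {} then 1 else 0)"
    and W_empty: "\<And>l. W {} (Suc l) = 0"
    and W_Suc: "\<And>A x l. finite A \<Longrightarrow> x \<in> A \<Longrightarrow>
          W A (Suc l) = (\<Sum>B | x \<in> B \<and> B \<subseteq> A. w (card B) * W (A - B) l)"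
    and w_0: "w 0 = 0"
    and G: "G = Abs_fps (\<lambda>n. real (w n) / fact n)"
    and A: "finite A"
  shows "real (W A l) = fact (card A) * (G ^ l) $ card A / fact l"
  using A
proof (induction l arbitrary: A)
  case 0
  then show ?case by (simp add: W_0)
next
  case (Suc l)
  show ?case
  proof (cases "A = {}")
    case True
    then show ?thesis by (simp add: W_empty G w_0)
  next
    case False
    then obtain x where x: "x \<in> A" by blast
    obtain n where n: "card A = Suc n"
      using x Suc.prems by (metis card_Suc_Diff1)
    have "real (W A (Suc l))
        = (\<Sum>B | x \<in> B \<and> B \<subseteq> A. real (w (card B)) *
            (fact (Suc n - card B) * (G ^ l) $ (Suc n - card B) / fact l))"
      unfolding W_Suc[OF Suc.prems x] of_nat_sum of_nat_mult
    proof (intro sum.cong refl)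
      fix B assume "B \<in> {B. x \<in> B \<and> B \<subseteq> A}"
      then have "card (A - B) = Suc n - card B"
        using Suc.prems n card_Diff_subset[of B A] finite_subset[of B A] by simp
      then show "real (w (card B)) * real (W (A - B) l) = real (w (card B)) *
            (fact (Suc n - card B) * (G ^ l) $ (Suc n - card B) / fact l)"
        using Suc.IH[of "A - B"] Suc.prems by simp
    qed
    \<comment> \<open>The block of \<open>x\<close> has \<open>i\<close> further elements.\<close>
    also have "\<dots> = (\<Sum>i=0..n. real (n choose i) * (real (w (Suc i)) *
            (fact (n - i) * (G ^ l) $ (n - i) / fact l)))"
      by (subst sum_subsets_containing[OF Suc.prems x n]) simp
    also have "\<dots> = fact n / fact l * (\<Sum>i=0..n. fps_deriv G $ i * (G ^ l) $ (n - i))"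
      unfolding sum_distrib_left
    proof (intro sum.cong refl)
      fix i assume "i \<in> {0..n}"
      then have "real (n choose i) = fact n / (fact i * fact (n - i))"
        by (simp add: binomial_fact)
      moreover have "fps_deriv G $ i = real (w (Suc i)) / fact i"
        by (simp add: G del: of_nat_Suc)
      ultimately show "real (n choose i) * (real (w (Suc i)) *
            (fact (n - i) * (G ^ l) $ (n - i) / fact l))
          = fact n / fact l * (fps_deriv G $ i * (G ^ l) $ (n - i))"
        by simp
    qed
    also have "\<dots> = fact n / fact (Suc l) * fps_deriv (G ^ Suc l) $ n"
      unfolding fps_mult_nth[symmetric]
      by (subst fps_deriv_power) (simp add: mult.assoc divide_simps del: power_Suc)
    also have "\<dots> = fact (card A) * (G ^ Suc l) $ card A / fact (Suc l)"
      by (simp add: n del: power_Suc)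
    finally show ?thesis .
  qed
qed

section \<open>Set partitions\<close>

text \<open>
  Partitions of \<open>A\<close> into \<open>k\<close> blocks, each with at least three elements.
\<close>

definition big_partitions :: "'a set \<Rightarrow> nat \<Rightarrow> 'a set set set" where
  "big_partitions A k = {P. partition_on A P \<and> card P = k \<and> (\<forall>B\<in>P. 3 \<le> card B)}"

lemma finite_big_partitions: "finite A \<Longrightarrow> finite (big_partitions A k)"
  by (rule finite_subset[of _ "Pow (Pow A)"]) (auto simp: big_partitions_def partition_on_def)

lemma card_big_partitions_Suc:
  assumes A: "finite A" and x: "x \<in> A"
  shows "card (big_partitions A (Suc l))
    = (\<Sum>B | x \<in> B \<and> B \<subseteq> A. (if 3 \<le> card B then 1 else 0) * card (big_partitions (A - B) l))"
proof -
  define \<B> where "\<B> = {B. x \<in> B \<and> B \<subseteq> A \<and> 3 \<le> card B}"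
  have fin: "finite \<B>"
    by (rule finite_subset[of _ "Pow A"]) (use A in \<open>auto simp: \<B>_def\<close>)
  have disj: "disjnt B (\<Union>Q)" if "partition_on (A - B) Q" for B Q
    using partition_onD1[OF that] by (auto simp: disjnt_def)
  have "bij_betw (\<lambda>(B, Q). insert B Q) (Sigma \<B> (\<lambda>B. big_partitions (A - B) l))
          (big_partitions A (Suc l))"
  \<comment> \<open>The set of blocks containing \<open>x\<close> is a singleton, so its union is the block of \<open>x\<close>.\<close>
  proof (rule bij_betw_byWitness[where f' = "\<lambda>P. (\<Union>{B \<in> P. x \<in> B}, P - {\<Union>{B \<in> P. x \<in> B}})"])
    have "\<Union>{C \<in> insert B Q. x \<in> C} = B \<and> insert B Q - {B} = Q"
      if B: "B \<in> \<B>" and Q: "Q \<in> big_partitions (A - B) l" for B Q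
    proof -
      have "\<Union>Q = A - B"
        using Q partition_onD1 by (auto simp: big_partitions_def)
      then have "{C \<in> insert B Q. x \<in> C} = {B}" "B \<notin> Q"
        using B by (auto simp: \<B>_def)
      then show ?thesis by simp
    qed
    then show "\<forall>z\<in>Sigma \<B> (\<lambda>B. big_partitions (A - B) l).
      (\<lambda>P. (\<Union>{B \<in> P. x \<in> B}, P - {\<Union>{B \<in> P. x \<in> B}})) ((\<lambda>(B, Q). insert B Q) z) = z"
      by auto
    have block: "\<exists>B. B \<in> P \<and> x \<in> B \<and> \<Union>{C \<in> P. x \<in> C} = B" if P: "partition_on A P" for P
    proof -
      obtain B where B: "B \<in> P" "x \<in> B" using partition_onD1[OF P] x by blast
      then have "{C \<in> P. x \<in> C} = {B}"
        using partition_onD2[OF P] by (auto simp: disjoint_def)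
      with B show ?thesis by auto
    qed
    show "\<forall>P\<in>big_partitions A (Suc l).
      (\<lambda>(B, Q). insert B Q) (\<Union>{B \<in> P. x \<in> B}, P - {\<Union>{B \<in> P. x \<in> B}}) = P"
    proof
      fix P assume "P \<in> big_partitions A (Suc l)"
      then obtain B where "B \<in> P" "\<Union>{C \<in> P. x \<in> C} = B"
        using block[of P] by (auto simp: big_partitions_def)
      then show "(\<lambda>(B, Q). insert B Q) (\<Union>{B \<in> P. x \<in> B}, P - {\<Union>{B \<in> P. x \<in> B}}) = P"
        by auto
    qed
    show "(\<lambda>(B, Q). insert B Q) ` Sigma \<B> (\<lambda>B. big_partitions (A - B) l) \<subseteq> big_partitions A (Suc l)"
    proof clarify
      fix B Q assume B: "B \<in> \<B>" and Q: "Q \<in> big_partitions (A - B) l"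
      then have Q': "partition_on (A - B) Q" "card Q = l" "\<forall>C\<in>Q. 3 \<le> card C"
        by (auto simp: big_partitions_def)
      have "finite Q" using finite_elements[OF _ Q'(1)] A by simp
      moreover have "B \<notin> Q" using B partition_onD1[OF Q'(1)] by (auto simp: \<B>_def)
      moreover have "partition_on A (insert B Q)"
        using disj[OF Q'(1)] Q'(1) B by (subst partition_on_insert) (auto simp: \<B>_def)
      ultimately show "insert B Q \<in> big_partitions A (Suc l)"
        using Q' B by (auto simp: big_partitions_def \<B>_def)
    qed
    show "(\<lambda>P. (\<Union>{B \<in> P. x \<in> B}, P - {\<Union>{B \<in> P. x \<in> B}})) ` big_partitions A (Suc l)
      \<subseteq> Sigma \<B> (\<lambda>B. big_partitions (A - B) l)"
    proof (rule image_subsetI)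
      fix P assume "P \<in> big_partitions A (Suc l)"
      then have P: "partition_on A P" "card P = Suc l" "\<forall>C\<in>P. 3 \<le> card C"
        by (auto simp: big_partitions_def)
      obtain B where B: "B \<in> P" "x \<in> B" "\<Union>{C \<in> P. x \<in> C} = B" using block[OF P(1)] by blast
      have "finite P" using P(2) card_ge_0_finite by force
      have BA: "B \<subseteq> A" using B partition_onD1[OF P(1)] by auto
      have dB: "disjnt B (\<Union>(P - {B}))"
        using partition_onD2[OF P(1)] B(1) unfolding disjnt_def disjoint_def by blast
      have "partition_on A (insert B (P - {B}))" using P(1) B by (simp add: insert_absorb)
      then have "partition_on (A - B) (P - {B})"
        using partition_on_insert[OF dB] by simp
      moreover have "card (P - {B}) = l" using P(2) B \<open>finite P\<close> by simp
      ultimately show "(\<Union>{B \<in> P. x \<in> B}, P - {\<Union>{B \<in> P. x \<in> B}})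
          \<in> Sigma \<B> (\<lambda>B. big_partitions (A - B) l)"
        unfolding B(3) using P(3) B BA by (auto simp: big_partitions_def \<B>_def)
    qed
  qed
  then have "card (big_partitions A (Suc l)) = card (Sigma \<B> (\<lambda>B. big_partitions (A - B) l))"
    by (rule bij_betw_same_card[symmetric])
  also have "\<dots> = (\<Sum>B\<in>\<B>. card (big_partitions (A - B) l))"
    using fin A by (intro card_SigmaI) (auto simp: finite_big_partitions)
  also have "\<dots> = (\<Sum>B | x \<in> B \<and> B \<subseteq> A. (if 3 \<le> card B then 1 else 0) * card (big_partitions (A - B) l))"
  proof (intro sum.mono_neutral_cong_left)
    show "finite {B. x \<in> B \<and> B \<subseteq> A}"
      by (rule finite_subset[of _ "Pow A"]) (use A in auto)
  qed (auto simp: \<B>_def)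
  finally show ?thesis .
qed

lemma S3_egf:
  "real (S3 n j) = fact n * (Abs_fps (\<lambda>n. real (if 3 \<le> n then 1 else 0) / fact n) ^ j) $ n / fact j"
proof -
  have "real (card (big_partitions A l)) = fact (card A) *
      (Abs_fps (\<lambda>n. real (if 3 \<le> n then 1 else 0) / fact n) ^ l) $ card A / fact l"
    if "finite A" for A :: "nat set" and l
  proof (rule egf_of_block_recursion[where w = "\<lambda>n. if 3 \<le> n then 1 else 0" and
        W = "\<lambda>A l. card (big_partitions A l)"])
    fix A :: "nat set" assume "finite A"
    have "big_partitions A 0 = (if A = {} then {{}} else {})"
      using finite_elements[OF \<open>finite A\<close>]
      by (auto simp: big_partitions_def partition_on_empty) (auto simp: partition_on_def)
    then show "card (big_partitions A 0) = (if A = {} then 1 else 0)" by simp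
  next
    fix l
    have "big_partitions ({} :: nat set) (Suc l) = {}"
      by (auto simp: big_partitions_def partition_on_empty)
    then show "card (big_partitions ({} :: nat set) (Suc l)) = 0" by simp
  qed (use that card_big_partitions_Suc in auto)
  from this[of "{..<n}" j] show ?thesis
    by (simp add: S3_def big_partitions_def)
qed

section \<open>Permutations and their cycles\<close>

text \<open>
  Permutations of \<open>A\<close> with \<open>l\<close> cycles, each of length at least three.
\<close>

definition big_permutations :: "'a set \<Rightarrow> nat \<Rightarrow> ('a \<Rightarrow> 'a) set" where
  "big_permutations A l = {p. p permutes A \<and> card (perm_cycles A p) = l \<and>
                     (\<forall>C\<in>perm_cycles A p. 3 \<le> card C)}"

text \<open>
  Permutations of \<open>B\<close> that consist of a single cycle. As \<open>cyclic_on\<close> requires a nonempty set,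
  there are none when \<open>B\<close> is empty.
\<close>

definition cyclic_permutations :: "'a set \<Rightarrow> ('a \<Rightarrow> 'a) set" where
  "cyclic_permutations B = {q. q permutes B \<and> cyclic_on q B}"

text \<open>
  A cycle \<open>q\<close> on a set \<open>B\<close> containing \<open>x\<close> and a permutation \<open>r\<close> of the rest of \<open>A\<close> are recovered from
  their product. Together with the next lemma, this makes \<open>(B, q, r) \<mapsto> q \<circ> r\<close> a bijection onto the
  permutations of \<open>A\<close>.
\<close>

lemma cycle_times_permutation:
  assumes B: "x \<in> B" "B \<subseteq> A"
    and q: "q \<in> cyclic_permutations B" and r: "r permutes A - B"
  shows "q \<circ> r permutes A" "orbit (q \<circ> r) x = B"
    "perm_restrict (q \<circ> r) B = q" "perm_restrict (q \<circ> r) (A - B) = r"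
    "perm_cycles A (q \<circ> r) = insert B (perm_cycles (A - B) r)"
proof -
  from q have q': "q permutes B" "cyclic_on q B" by (auto simp: cyclic_permutations_def)
  have r_B: "r y = y" if "y \<in> B" for y using permutes_not_in[OF r] that by auto
  have q_r: "q (r y) = r y" if "y \<notin> B" for y
    using that permutes_not_in[OF q'(1)] permutes_in_image[OF r, of y] permutes_not_in[OF r, of y]
    by (metis DiffD2)
  show "q \<circ> r permutes A"
    using B by (intro permutes_compose permutes_subset[OF q'(1)] permutes_subset[OF r]) auto
  have cyc: "cyclic_on (q \<circ> r) B"
    by (rule permutes_comp_preserves_cyclic1[OF r q'(2), of B]) auto
  then show "orbit (q \<circ> r) x = B" using B orbit_cyclic_eq3 by metis
  show "perm_restrict (q \<circ> r) B = q"
    using permutes_not_in[OF q'(1)] by (auto simp: perm_restrict_def r_B fun_eq_iff)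
  show "perm_restrict (q \<circ> r) (A - B) = r"
    using permutes_not_in[OF r] by (auto simp: perm_restrict_def q_r fun_eq_iff)
  have "orbit (q \<circ> r) y = orbit r y" if "y \<in> A - B" for y
    using that permutes_in_image[OF r] by (intro orbit_cong0[of y "A - B"]) (auto simp: q_r)
  then have "orbit (q \<circ> r) ` (A - B) = orbit r ` (A - B)" by auto
  moreover have "orbit (q \<circ> r) ` B = {B}"
    using B orbit_cyclic_eq3[OF cyc] by auto
  moreover have "A = B \<union> (A - B)" using B by auto
  ultimately show "perm_cycles A (q \<circ> r) = insert B (perm_cycles (A - B) r)"
    unfolding perm_cycles_def by (metis image_Un insert_is_Un)
qed

lemma permutation_split_off_cycle:
  assumes A: "finite A" and x: "x \<in> A" and p: "p permutes A"
  defines "B \<equiv> orbit p x"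
  shows "x \<in> B" "B \<subseteq> A" "perm_restrict p B \<in> cyclic_permutations B"
    "perm_restrict p (A - B) permutes A - B"
    "perm_restrict p B \<circ> perm_restrict p (A - B) = p"
proof -
  show B: "x \<in> B" "B \<subseteq> A"
    using permutation_self_in_orbit permutes_imp_permutation[OF A p] permutes_orbit_subset[OF p x]
    by (auto simp: B_def)
  have cyc: "cyclic_on p B" unfolding B_def by (rule cyclic_on_orbit[OF p A])
  show pAB: "perm_restrict p (A - B) permutes A - B"
    by (rule perm_restrict_diff_cyclic[OF p cyc])
  have "p ` B \<subseteq> B" using cyclic_on_inI[OF cyc] by auto
  moreover have "inj_on p B" using permutes_inj_on[OF p] .
  moreover have "finite B" using A B finite_subset by blast
  ultimately have "bij_betw p B B" by (simp add: bij_betw_def endo_inj_surj)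
  then have "bij_betw (perm_restrict p B) B B"
    by (subst bij_betw_cong[where g = p]) (auto simp: perm_restrict_def)
  then have pB: "perm_restrict p B permutes B"
    by (rule bij_imp_permutes) (simp add: perm_restrict_def)
  then show "perm_restrict p B \<in> cyclic_permutations B"
    using cyc by (simp add: cyclic_permutations_def cyclic_on_perm_restrict)
  have "perm_restrict p B \<circ> perm_restrict p (A - B) = perm_restrict p (B \<union> (A - B))"
    by (rule perm_restrict_union[OF pB pAB]) auto
  also have "B \<union> (A - B) = A" using B by auto
  finally show "perm_restrict p B \<circ> perm_restrict p (A - B) = p"
    by (simp only: perm_restrict_id[OF p])
qed

text \<open>
  Permutations whose set of cycles satisfies \<open>Q\<close>, counted by the support \<open>B\<close> of the cycle of \<open>x\<close>.
\<close>

lemma card_permutations_by_cycle: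
  assumes A: "finite A" and x: "x \<in> A"
  shows "card {p. p permutes A \<and> Q (perm_cycles A p)}
    = (\<Sum>B | x \<in> B \<and> B \<subseteq> A. card (cyclic_permutations B) *
        card {r. r permutes A - B \<and> Q (insert B (perm_cycles (A - B) r))})"
proof -
  define \<B> where "\<B> = {B. x \<in> B \<and> B \<subseteq> A}"
  define R where "R = (\<lambda>B. {r. r permutes A - B \<and> Q (insert B (perm_cycles (A - B) r))})"
  have fin: "finite \<B>"
    by (rule finite_subset[of _ "Pow A"]) (use A in \<open>auto simp: \<B>_def\<close>)
  have fin2: "finite (cyclic_permutations B)" "finite (R B)" if "B \<in> \<B>" for B
  proof -
    have "finite B" using that A finite_subset by (auto simp: \<B>_def)
    then show "finite (cyclic_permutations B)"
      by (rule finite_subset[rotated, OF finite_permutations]) (auto simp: cyclic_permutations_def)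
    show "finite (R B)"
      by (rule finite_subset[rotated, OF finite_permutations[of "A - B"]]) (auto simp: R_def A)
  qed
  have "bij_betw (\<lambda>(B, q, r). q \<circ> r) (Sigma \<B> (\<lambda>B. cyclic_permutations B \<times> R B))
      {p. p permutes A \<and> Q (perm_cycles A p)}"
  proof (rule bij_betw_byWitness[where f' =
        "\<lambda>p. (orbit p x, perm_restrict p (orbit p x), perm_restrict p (A - orbit p x))"])
    show "\<forall>z\<in>Sigma \<B> (\<lambda>B. cyclic_permutations B \<times> R B).
      (\<lambda>p. (orbit p x, perm_restrict p (orbit p x), perm_restrict p (A - orbit p x)))
        ((\<lambda>(B, q, r). q \<circ> r) z) = z"
      using cycle_times_permutation(2-4)[where A = A and x = x] by (auto simp: \<B>_def R_def)
    show "\<forall>p\<in>{p. p permutes A \<and> Q (perm_cycles A p)}. (\<lambda>(B, q, r). q \<circ> r)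
        (orbit p x, perm_restrict p (orbit p x), perm_restrict p (A - orbit p x)) = p"
      using permutation_split_off_cycle(5)[OF A x] by auto
    show "(\<lambda>(B, q, r). q \<circ> r) ` Sigma \<B> (\<lambda>B. cyclic_permutations B \<times> R B)
        \<subseteq> {p. p permutes A \<and> Q (perm_cycles A p)}"
      using cycle_times_permutation(1,5)[where A = A and x = x] by (auto simp: \<B>_def R_def)
    show "(\<lambda>p. (orbit p x, perm_restrict p (orbit p x), perm_restrict p (A - orbit p x))) `
        {p. p permutes A \<and> Q (perm_cycles A p)} \<subseteq> Sigma \<B> (\<lambda>B. cyclic_permutations B \<times> R B)"
    proof (rule image_subsetI)
      fix p assume p: "p \<in> {p. p permutes A \<and> Q (perm_cycles A p)}"
      then have "p permutes A" by simp
      note split = permutation_split_off_cycle[OF A x this]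
      show "(orbit p x, perm_restrict p (orbit p x), perm_restrict p (A - orbit p x))
          \<in> Sigma \<B> (\<lambda>B. cyclic_permutations B \<times> R B)"
        using p split cycle_times_permutation(5)[OF split(1-4)] by (auto simp: \<B>_def R_def)
    qed
  qed
  then have "card {p. p permutes A \<and> Q (perm_cycles A p)}
      = card (Sigma \<B> (\<lambda>B. cyclic_permutations B \<times> R B))"
    by (rule bij_betw_same_card[symmetric])
  also have "\<dots> = (\<Sum>B\<in>\<B>. card (cyclic_permutations B \<times> R B))"
    using fin fin2 by (intro card_SigmaI) auto
  finally show ?thesis by (simp add: card_cartesian_product \<B>_def R_def)
qed

lemma card_cyclic_permutations:
  assumes "finite B" "B \<noteq> {}"
  shows "card (cyclic_permutations B) = fact (card B - 1)"
  using assms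
proof (induction B rule: finite_psubset_induct)
  case (psubset B)
  then obtain x where x: "x \<in> B" by blast
  obtain n where n: "card B = Suc n" using x psubset.hyps by (metis card_Suc_Diff1)
  define \<B> where "\<B> = {C. x \<in> C \<and> C \<subseteq> B}"
  have fin: "finite \<B>"
    by (rule finite_subset[of _ "Pow B"]) (use psubset.hyps in \<open>auto simp: \<B>_def\<close>)
  have BB: "B \<in> \<B>" using x by (simp add: \<B>_def)
  have card_diff: "card (B - C) = Suc n - card C" if "C \<in> \<B>" for C
    using that psubset.hyps n card_Diff_subset[of C B] finite_subset[of C B] by (simp add: \<B>_def)
  \<comment> \<open>All permutations of \<open>B\<close>, classified by the cycle of \<open>x\<close>; the term for \<open>B\<close> itself is the unknown.\<close>
  have "fact (Suc n) = card {p. p permutes B \<and> True}"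
    using card_permutations[OF n] psubset.hyps by simp
  also have "\<dots> = (\<Sum>C\<in>\<B>. card (cyclic_permutations C) * fact (card (B - C)))"
    unfolding \<B>_def using psubset.hyps x
    by (subst card_permutations_by_cycle) (simp_all add: card_permutations)
  also have "\<dots> = card (cyclic_permutations B)
      + (\<Sum>C\<in>\<B> - {B}. card (cyclic_permutations C) * fact (card (B - C)))"
    using sum.remove[OF fin BB, of "\<lambda>C. card (cyclic_permutations C) * fact (card (B - C))"] by simp
  also have "(\<Sum>C\<in>\<B> - {B}. card (cyclic_permutations C) * fact (card (B - C)))
      = (\<Sum>C\<in>\<B> - {B}. fact (card C - 1) * fact (Suc n - card C))"
    by (intro sum.cong refl) (use psubset.IH card_diff in \<open>auto simp: \<B>_def\<close>)
  finally have 1: "fact (Suc n) = card (cyclic_permutations B)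
      + (\<Sum>C\<in>\<B> - {B}. fact (card C - 1) * fact (Suc n - card C))" .

  \<comment> \<open>The claimed values satisfy the same equation.\<close>
  have "(\<Sum>C\<in>\<B>. fact (card C - 1) * fact (Suc n - card C) :: nat)
      = (\<Sum>i=0..n. (n choose i) * (fact i * fact (n - i)))"
    unfolding \<B>_def using psubset.hyps x n
    by (subst sum_subsets_containing[where n = n]) simp_all
  also have "\<dots> = (\<Sum>i=0..n. fact n)"
    by (intro sum.cong refl) (simp add: binomial_fact_lemma[symmetric] mult_ac)
  also have "\<dots> = fact (Suc n)" by simp
  finally have "fact (Suc n) = (\<Sum>C\<in>\<B>. fact (card C - 1) * fact (Suc n - card C) :: nat)" ..
  also have "\<dots> = fact (card B - 1) + (\<Sum>C\<in>\<B> - {B}. fact (card C - 1) * fact (Suc n - card C))"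
    using sum.remove[OF fin BB, of "\<lambda>C. fact (card C - 1) * fact (Suc n - card C)"] n by simp
  finally have 2: "fact (Suc n) = fact (card B - 1)
      + (\<Sum>C\<in>\<B> - {B}. fact (card C - 1) * fact (Suc n - card C) :: nat)" .
  from 1 2 show ?case by linarith
qed

lemma card_big_permutations_Suc:
  assumes A: "finite A" and x: "x \<in> A"
  shows "card (big_permutations A (Suc l))
    = (\<Sum>B | x \<in> B \<and> B \<subseteq> A. (if 3 \<le> card B then fact (card B - 1) else 0)
        * card (big_permutations (A - B) l))"
proof -
  define Q where "Q = (\<lambda>\<C> :: 'a set set. card \<C> = Suc l \<and> (\<forall>C\<in>\<C>. 3 \<le> card C))"
  have "card (big_permutations A (Suc l))
      = (\<Sum>B | x \<in> B \<and> B \<subseteq> A. card (cyclic_permutations B) *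
        card {r. r permutes A - B \<and> Q (insert B (perm_cycles (A - B) r))})"
    using card_permutations_by_cycle[OF A x, of Q] by (simp add: big_permutations_def Q_def)
  also have "\<dots> = (\<Sum>B | x \<in> B \<and> B \<subseteq> A. (if 3 \<le> card B then fact (card B - 1) else 0)
        * card (big_permutations (A - B) l))"
  proof (intro sum.cong refl)
    fix B assume "B \<in> {B. x \<in> B \<and> B \<subseteq> A}"
    then have B: "x \<in> B" "B \<subseteq> A" by auto
    have c: "card (cyclic_permutations B) = fact (card B - 1)"
      using B A by (intro card_cyclic_permutations) (auto intro: finite_subset)
    have "Q (insert B (perm_cycles (A - B) r)) \<longleftrightarrow> 3 \<le> card B \<and> r \<in> big_permutations (A - B) l"
      if r: "r permutes A - B" for r
    proof -
      have "B \<notin> perm_cycles (A - B) r"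
        using permutes_orbit_subset[OF r] B by (auto simp: perm_cycles_def)
      moreover have "finite (perm_cycles (A - B) r)" using A by (simp add: perm_cycles_def)
      ultimately show ?thesis using r by (auto simp: Q_def big_permutations_def)
    qed
    then have "{r. r permutes A - B \<and> Q (insert B (perm_cycles (A - B) r))}
        = (if 3 \<le> card B then big_permutations (A - B) l else {})"
      by (auto simp: big_permutations_def)
    then show "card (cyclic_permutations B) *
        card {r. r permutes A - B \<and> Q (insert B (perm_cycles (A - B) r))}
      = (if 3 \<le> card B then fact (card B - 1) else 0) * card (big_permutations (A - B) l)"
      by (simp add: c)
  qed
  finally show ?thesis .
qed

lemma d3_egf:
  "real (d3 n j) = fact n *
    (Abs_fps (\<lambda>n. real (if 3 \<le> n then fact (n - 1) else 0) / fact n) ^ j) $ n / fact j"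
proof -
  have "real (card (big_permutations A l)) = fact (card A) *
      (Abs_fps (\<lambda>n. real (if 3 \<le> n then fact (n - 1) else 0) / fact n) ^ l) $ card A / fact l"
    if "finite A" for A :: "nat set" and l
  proof (rule egf_of_block_recursion[where w = "\<lambda>n. if 3 \<le> n then fact (n - 1) else 0" and
        W = "\<lambda>A l. card (big_permutations A l)"])
    fix A :: "nat set" assume "finite A"
    then have "big_permutations A 0 = (if A = {} then {id} else {})"
      by (auto simp: big_permutations_def perm_cycles_def)
    then show "card (big_permutations A 0) = (if A = {} then 1 else 0)" by simp
  next
    fix l
    have "big_permutations ({} :: nat set) (Suc l) = {}"
      by (auto simp: big_permutations_def perm_cycles_def)
    then show "card (big_permutations ({} :: nat set) (Suc l)) = 0" by simp
  qed (use that card_big_permutations_Suc in auto)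
  from this[of "{..<n}" j] show ?thesis
    by (simp add: d3_def big_permutations_def)
qed

section \<open>Residues of formal power series\<close>

text \<open>
  With \<open>\<phi> = x h\<close>, the left-hand side is the residue of \<open>\<phi>' / \<phi>^(r+1)\<close>, which is 1 if \<open>r = 0\<close> and
  otherwise 0, the residue of a derivative.
\<close>

lemma residue_derivative_power:
  fixes h :: "real fps"
  assumes "h $ 0 \<noteq> 0"
  shows "((h + fps_X * fps_deriv h) * inverse h ^ (r + 1)) $ r = (if r = 0 then 1 else 0)"
proof -
  define i where "i = inverse h"
  have hi: "h * i = 1"
    using assms by (simp add: i_def inverse_mult_eq_1')
  have split: "(h + fps_X * fps_deriv h) * i ^ (r + 1) = i ^ r + fps_X * (fps_deriv h * i ^ (r + 1))"
  proof -
    have "h * i ^ (r + 1) = i ^ r"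
      using hi by (simp add: mult.assoc[symmetric])
    then show ?thesis by (simp add: distrib_right mult.assoc)
  qed
  show ?thesis
  proof (cases r)
    case 0
    with split show ?thesis by (simp add: i_def)
  next
    case (Suc q)
    have i': "fps_deriv i = - (fps_deriv h * i ^ 2)"
      using fps_inverse_deriv[OF assms] by (simp add: i_def)
    have "of_nat (Suc q) * (i ^ Suc q) $ Suc q = fps_deriv (i ^ Suc q) $ q"
      by (simp add: fps_deriv_nth del: power_Suc)
    also have "fps_deriv (i ^ Suc q) = fps_const (of_nat (Suc q)) * fps_deriv i * i ^ q"
      by (subst fps_deriv_power) simp
    also have "\<dots> = - (fps_const (of_nat (Suc q)) * (fps_deriv h * i ^ (r + 1)))"
      by (simp add: i' Suc power2_eq_square mult_ac)
    finally have "of_nat (Suc q) * (i ^ Suc q) $ Suc q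
        = of_nat (Suc q) * (- (fps_deriv h * i ^ (r + 1)) $ q)"
      by (simp del: power_Suc)
    then have "(i ^ Suc q) $ Suc q = - (fps_deriv h * i ^ (r + 1)) $ q"
      by (simp only: mult_cancel_left) simp
    then show ?thesis
      using split by (simp add: i_def Suc)
  qed
qed

text \<open>
  The residue of \<open>H(y) / y^(n+1) dy\<close> does not change under the substitution \<open>y = x h(x)\<close>.
\<close>

lemma residue_change_of_variable:
  fixes H h :: "real fps"
  assumes "h $ 0 \<noteq> 0"
  shows "((H oo (fps_X * h)) * fps_deriv (fps_X * h) * inverse h ^ (n + 1)) $ n = H $ n"
proof -
  define \<phi> where "\<phi> = fps_X * h"
  define K where "K = fps_deriv \<phi> * inverse h ^ (n + 1)"
  \<comment> \<open>Only the terms of \<open>H\<close> of degree at most \<open>n\<close> matter, so \<open>H\<close> may be taken to be a monomial.\<close>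
  have coeff: "(H oo \<phi>) $ i = (\<Sum>m=0..n. fps_const (H $ m) * \<phi> ^ m) $ i" if "i \<le> n" for i
  proof -
    have "(\<Sum>m=0..i. H $ m * (\<phi> ^ m) $ i) = (\<Sum>m=0..n. H $ m * (\<phi> ^ m) $ i)"
      using that by (intro sum.mono_neutral_left)
        (auto simp: \<phi>_def power_mult_distrib fps_X_power_mult_nth)
    then show ?thesis by (simp add: fps_compose_nth fps_sum_nth)
  qed
  have monomial: "(\<phi> ^ m * K) $ n = (if m = n then 1 else 0)" if "m \<le> n" for m
  proof -
    have hi: "h * inverse h = 1"
      using assms by (simp add: inverse_mult_eq_1')
    have "h ^ m * inverse h ^ (n + 1) = (h * inverse h) ^ m * inverse h ^ (n - m + 1)"
      using that by (simp add: power_mult_distrib mult.assoc flip: power_add)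
    then have "h ^ m * inverse h ^ (n + 1) = inverse h ^ (n - m + 1)"
      using hi by simp
    moreover have "\<phi> ^ m * K = fps_X ^ m *
        ((h + fps_X * fps_deriv h) * (h ^ m * inverse h ^ (n + 1)))"
      by (simp add: K_def \<phi>_def power_mult_distrib algebra_simps)
    ultimately have "(\<phi> ^ m * K) $ n
        = ((h + fps_X * fps_deriv h) * inverse h ^ (n - m + 1)) $ (n - m)"
      using that by (simp only: fps_X_power_mult_nth) simp
    also have "\<dots> = (if n - m = 0 then 1 else 0)"
      by (rule residue_derivative_power[OF assms])
    finally show ?thesis using that by auto
  qed
  have "((H oo \<phi>) * K) $ n = ((\<Sum>m=0..n. fps_const (H $ m) * \<phi> ^ m) * K) $ n"
    unfolding fps_mult_nth by (intro sum.cong refl) (simp only: coeff atLeastAtMost_iff)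
  also have "\<dots> = (\<Sum>m=0..n. H $ m * (\<phi> ^ m * K) $ n)"
    by (simp add: sum_distrib_right fps_sum_nth mult.assoc)
  also have "\<dots> = (\<Sum>m=0..n. if m = n then H $ m else 0)"
    by (intro sum.cong) (auto simp: monomial)
  also have "\<dots> = H $ n" by simp
  finally show ?thesis by (simp add: K_def \<phi>_def mult.assoc)
qed

section \<open>Alternating sums as coefficients of a binomial series\<close>

text \<open>
  The square root with constant term 1 of a power series \<open>F\<close> with constant term 1, given by the binomial
  series. For other \<open>F\<close> it has no meaning.
\<close>

definition sqrt_fps :: "real fps \<Rightarrow> real fps" where
  "sqrt_fps F = fps_binomial (1 / 2) oo (F - 1)"

lemma sqrt_fps_nth_0 [simp]: "sqrt_fps F $ 0 = 1"
  by (simp add: sqrt_fps_def)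

lemma sqrt_fps_square:
  assumes "F $ 0 = 1"
  shows "sqrt_fps F ^ 2 = F"
proof -
  have "sqrt_fps F ^ 2 = fps_binomial (1 / 2) ^ 2 oo (F - 1)"
    unfolding sqrt_fps_def by (rule fps_compose_power) (simp add: assms)
  also have "\<dots> = F"
    by (simp add: fps_binomial_power fps_binomial_1 fps_compose_add_distrib assms)
  finally show ?thesis .
qed

lemma inverse_sqrt_fps_power:
  assumes "F $ 0 = 1"
  shows "inverse (sqrt_fps F) ^ m = fps_binomial (- (of_nat m / 2)) oo (F - 1)"
proof -
  have "sqrt_fps F * (fps_binomial (- 1 / 2) oo (F - 1))
      = (fps_binomial (1 / 2) * fps_binomial (- 1 / 2)) oo (F - 1)"
    unfolding sqrt_fps_def by (rule fps_compose_mult_distrib[symmetric]) (simp add: assms)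
  also have "\<dots> = 1"
    by (simp flip: fps_binomial_add_mult)
  finally have "inverse (sqrt_fps F) = fps_binomial (- 1 / 2) oo (F - 1)"
    by (rule fps_inverse_unique)
  then have "inverse (sqrt_fps F) ^ m = fps_binomial (- 1 / 2) ^ m oo (F - 1)"
    by (simp add: fps_compose_power assms)
  then show ?thesis by (simp add: fps_binomial_power)
qed

text \<open>
  As \<open>(2m)!/(2^m m!) = (2m-1)!!\<close>, this is the formula
  \<open>(-1)^j (2k+1) (2k+3) ... (2k+2j-1) / (2^j j!)\<close> for the binomial coefficient.
\<close>

lemma gbinomial_neg_half_odd:
  "(- 1) ^ j * fact (2 * (j + k)) / (2 ^ (j + k) * fact (j + k) * fact j * 2 ^ j)
    = fact (2 * k) / (2 ^ k * fact k) * ((- (of_nat (2 * k + 1) / 2) :: real) gchoose j)"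
proof (induction j)
  case 0
  show ?case by simp
next
  case (Suc j)
  let ?a = "- (of_nat (2 * k + 1) / 2) :: real"
  define L :: real where
    "L = (- 1) ^ j * fact (2 * (j + k)) / (2 ^ (j + k) * fact (j + k) * fact j * 2 ^ j)"
  have fact2: "fact (2 * (Suc j + k)) = (2 * real (j + k) + 2) * (2 * real (j + k) + 1) * fact (2 * (j + k))"
    by (simp add: algebra_simps)
  have f1: "fact (Suc j + k) = (real (j + k) + 1) * fact (j + k)"
    by (simp add: algebra_simps)
  have f2: "fact (Suc j) = (real j + 1) * fact j"
    by (simp add: algebra_simps)
  have nz: "real (j + k) + 1 \<noteq> 0" "real j + 1 \<noteq> 0"
    by linarith+
  have "(- 1) ^ Suc j * fact (2 * (Suc j + k)) / (2 ^ (Suc j + k) * fact (Suc j + k) * fact (Suc j) * 2 ^ Suc j)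
     = L * (- ((2 * real (j + k) + 2) * (2 * real (j + k) + 1)) / (4 * (real (j + k) + 1) * (real j + 1)))"
    unfolding fact2 f1 f2 L_def by (simp add: field_simps)
  also have "(- ((2 * real (j + k) + 2) * (2 * real (j + k) + 1)) / (4 * (real (j + k) + 1) * (real j + 1)))
     = (?a - of_nat j) / (real j + 1)"
    using nz by (simp add: divide_simps) (simp add: algebra_simps)
  also have "L = fact (2 * k) / (2 ^ k * fact k) * (?a gchoose j)"
    unfolding L_def by (rule Suc.IH)
  also have "\<dots> * ((?a - of_nat j) / (real j + 1)) =
     fact (2 * k) / (2 ^ k * fact k) * ((?a gchoose j) * (?a - of_nat j) / (real j + 1))"
    by simp
  also have "(?a gchoose j) * (?a - of_nat j) / (real j + 1) = (?a gchoose Suc j)"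
    using gbinomial_mult_1[of ?a j] nz by (simp add: field_simps)
  finally show ?case .
qed

text \<open>
  If \<open>N n j\<close> has exponential generating function \<open>G^j / j!\<close>, then the sum evaluates
  \<open>F^(-k-1/2)\<close> by the binomial series in \<open>F - 1 = 2 G / x\<^sup>2\<close>. The sum may stop at \<open>j = 2 k\<close> because
  \<open>F - 1\<close> has no constant term.
\<close>

lemma alternating_sum_eq_coeff:
  fixes F G :: "real fps" and N :: "nat \<Rightarrow> nat \<Rightarrow> nat"
  assumes F0: "F $ 0 = 1"
    and G: "fps_const 2 * G = fps_X ^ 2 * (F - 1)"
    and N: "\<And>n j. real (N n j) = fact n * (G ^ j) $ n / fact j"
  shows "(\<Sum>j=0..2*k. (-1) ^ j * real (N (2 * (j + k)) j) / (2 ^ (j + k) * fact (j + k)))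
    = fact (2 * k) / (2 ^ k * fact k) * (inverse (sqrt_fps F) ^ (2 * k + 1)) $ (2 * k)"
proof -
  \<comment> \<open>Since \<open>F - 1 = 2 G / x^2\<close>, passing from \<open>G^j\<close> to \<open>(F - 1)^j\<close> shifts the index by \<open>2 j\<close>.\<close>
  have Gj: "2 ^ j * (G ^ j) $ (2 * (j + k)) = ((F - 1) ^ j) $ (2 * k)" for j
  proof -
    have "(fps_const 2 * G) ^ j = fps_X ^ (2 * j) * (F - 1) ^ j"
      by (simp add: G power_mult_distrib power_mult)
    then have "((fps_const 2 * G) ^ j) $ (2 * (j + k)) = ((F - 1) ^ j) $ (2 * k)"
      by (simp add: fps_X_power_mult_nth)
    moreover have "(fps_const 2 * G) ^ j = fps_const (2 ^ j) * G ^ j"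
      by (simp add: power_mult_distrib fps_const_power)
    ultimately show ?thesis by simp
  qed
  have "(-1) ^ j * real (N (2 * (j + k)) j) / (2 ^ (j + k) * fact (j + k))
      = fact (2 * k) / (2 ^ k * fact k) *
        ((- (of_nat (2 * k + 1) / 2) gchoose j) * ((F - 1) ^ j) $ (2 * k))" for j
  proof -
    have "(-1) ^ j * real (N (2 * (j + k)) j) / (2 ^ (j + k) * fact (j + k))
      = (- 1) ^ j * fact (2 * (j + k)) / (2 ^ (j + k) * fact (j + k) * fact j * 2 ^ j)
        * (2 ^ j * (G ^ j) $ (2 * (j + k)))"
      by (simp add: N)
    then show ?thesis
      unfolding Gj gbinomial_neg_half_odd by (simp only: mult.assoc)
  qed
  then show ?thesis
    by (simp only: inverse_sqrt_fps_power[OF F0] fps_compose_nth fps_binomial_nth sum_distrib_left)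
qed


section \<open>The substitution relating the two series\<close>

text \<open>
  The assumptions say that \<open>L(y) = - ln (1 - y) - y\<close>. The two sides have the same derivative and
  the same constant term.
\<close>

lemma exponential_substitution:
  fixes L :: "real fps"
  assumes L: "(1 - fps_X) * fps_deriv L = fps_X" "L $ 0 = 0"
  shows "L oo (1 - fps_exp 1) = fps_exp 1 - 1 - fps_X"
proof -
  define e :: "real fps" where "e = fps_exp 1"
  have e0: "e $ 0 = 1" by (simp add: e_def)
  have "e * (fps_deriv L oo (1 - e)) = ((1 - fps_X) oo (1 - e)) * (fps_deriv L oo (1 - e))"
    by (simp add: fps_compose_sub_distrib e0)
  also have "\<dots> = ((1 - fps_X) * fps_deriv L) oo (1 - e)"
    by (rule fps_compose_mult_distrib[symmetric]) (simp add: e0)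
  also have "\<dots> = 1 - e"
    by (simp add: L e0)
  finally have *: "e * (fps_deriv L oo (1 - e)) = 1 - e" .
  have "fps_deriv (L oo (1 - e)) = (fps_deriv L oo (1 - e)) * fps_deriv (1 - e)"
    by (rule fps_compose_deriv) (simp add: e0)
  also have "\<dots> = - (e * (fps_deriv L oo (1 - e)))"
    by (simp add: e_def mult.commute)
  also have "\<dots> = fps_deriv (e - 1 - fps_X)"
    unfolding * by (simp add: e_def)
  finally have "L oo (1 - e) = fps_const ((L oo (1 - e)) $ 0 - (e - 1 - fps_X) $ 0) + (e - 1 - fps_X)"
    by (simp only: fps_deriv_eq_iff)
  then show ?thesis
    by (simp add: L e0 flip: e_def)
qed

text \<open>
  Here \<open>Fs\<close> is \<open>2 f(x)/x\<^sup>2\<close> with \<open>f(x) = exp x - 1 - x\<close>, and \<open>Fd\<close> is \<open>2 g(y)/y\<^sup>2\<close> with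
  \<open>g(y) = - ln (1 - y) - y\<close>, which is \<open>L\<close>.
\<close>

lemma coeff_exp_eq_coeff_log:
  fixes Fs Fd L :: "real fps"
  assumes L: "(1 - fps_X) * fps_deriv L = fps_X" "L $ 0 = 0"
    and Fs: "fps_X ^ 2 * Fs = fps_const 2 * (fps_exp 1 - 1 - fps_X)" "Fs $ 0 = 1"
    and Fd: "fps_X ^ 2 * Fd = fps_const 2 * L" "Fd $ 0 = 1"
    and k: "k > 0"
  shows "(inverse (sqrt_fps Fs) ^ (2 * k + 1)) $ (2 * k)
       = (inverse (sqrt_fps Fd) ^ (2 * k + 1)) $ (2 * k)"
proof -
  define e :: "real fps" where "e = fps_exp 1"
  define h where "h = fps_shift 1 (1 - e)"
  define s where "s = sqrt_fps Fs"
  define d where "d = sqrt_fps Fd"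
  define t where "t = d oo (fps_X * h)"
  have s2: "s ^ 2 = Fs" and d2: "d ^ 2 = Fd"
    by (simp_all add: s_def d_def sqrt_fps_square Fs Fd)
  have s0: "s $ 0 = 1" and d0: "d $ 0 = 1" by (simp_all add: s_def d_def)
  have e0: "e $ 0 = 1" and e': "fps_deriv e = e" by (simp_all add: e_def)
  have Xh: "fps_X * h = 1 - e"
    by (rule fps_ext) (simp add: h_def e0)
  have h0: "h $ 0 = - 1"
    by (simp add: h_def e_def)
  have t0: "t $ 0 = 1" by (simp add: t_def d0)

  \<comment> \<open>With \<open>h = y/x\<close> and \<open>t = sqrt Fd\<close> at \<open>y\<close>, \<open>g(y) = f(x)\<close> gives \<open>(t h)^2 = s^2\<close>; constant terms fix the sign.\<close>
  have "fps_X ^ 2 * (t * h) ^ 2 = ((fps_X ^ 2 * Fd) oo (fps_X * h))"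
    by (simp add: fps_compose_mult_distrib power_mult_distrib t_def fps_compose_power
        fps_X_power_compose flip: d2)
  also have "\<dots> = fps_const 2 * (L oo (1 - e))"
    by (simp add: Fd fps_compose_mult_distrib Xh e0)
  also have "\<dots> = fps_X ^ 2 * s ^ 2"
    using exponential_substitution[OF L] by (simp add: e_def s2 Fs)
  finally have "(t * h) ^ 2 = s ^ 2" by simp
  then have "t * h = s \<or> t * h = - s" by (simp add: power2_eq_iff)
  moreover have "t * h \<noteq> s"
  proof
    assume "t * h = s"
    then have "(t * h) $ 0 = s $ 0" by simp
    then show False by (simp add: t0 h0 s0)
  qed
  ultimately have th: "t * h = - s" by simp

  \<comment> \<open>Change of variable \<open>y = x h\<close> in the coefficient for \<open>g\<close>.\<close>
  have "(inverse d ^ (2 * k + 1)) $ (2 * k)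
      = (((inverse d ^ (2 * k + 1)) oo (fps_X * h)) * fps_deriv (fps_X * h)
          * inverse h ^ (2 * k + 1)) $ (2 * k)"
    by (rule residue_change_of_variable[symmetric]) (simp add: h0)
  also have "(inverse d ^ (2 * k + 1)) oo (fps_X * h) = inverse t ^ (2 * k + 1)"
    by (simp add: t_def d0 fps_inverse_compose del: power_Suc flip: fps_compose_power)
  also have "inverse t ^ (2 * k + 1) * fps_deriv (fps_X * h) * inverse h ^ (2 * k + 1)
      = - (e * inverse (t * h) ^ (2 * k + 1))"
    unfolding Xh by (simp add: e' fps_inverse_mult power_mult_distrib algebra_simps)
  also have "inverse (t * h) ^ (2 * k + 1) = - (inverse s ^ (2 * k + 1))"
    unfolding th by (simp add: fps_inverse_minus)
  finally have d_coeff: "(inverse d ^ (2 * k + 1)) $ (2 * k) = (e * inverse s ^ (2 * k + 1)) $ (2 * k)"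
    by simp

  \<comment> \<open>\<open>f = (x s)^2 / 2\<close> and \<open>f' = exp x - 1\<close>.\<close>
  have Xs: "(fps_X * s) ^ 2 = fps_const 2 * (fps_exp 1 - 1 - fps_X)"
    by (simp add: s2 power_mult_distrib Fs)
  have "fps_const 2 * (e - 1) = fps_deriv (fps_const 2 * (fps_exp 1 - 1 - fps_X))"
    by (simp add: e_def)
  also have "\<dots> = fps_deriv ((fps_X * s) ^ 2)"
    by (simp only: Xs)
  also have "\<dots> = fps_const 2 * (fps_X * s * (s + fps_X * fps_deriv s))"
    by (simp add: power2_eq_square numeral_fps_const algebra_simps)
  finally have e1: "e - 1 = fps_X * s * (s + fps_X * fps_deriv s)" by simp
  have ss: "s * inverse s = 1" by (simp add: s0 inverse_mult_eq_1')
  have "(e - 1) * inverse s ^ (2 * k + 1)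
      = (s * inverse s) * (fps_X * ((s + fps_X * fps_deriv s) * inverse s ^ (2 * k)))"
    unfolding e1 by (simp add: mult_ac)
  also have "\<dots> = fps_X * ((s + fps_X * fps_deriv s) * inverse s ^ (2 * k - 1 + 1))"
    unfolding ss using k by simp
  finally have "((e - 1) * inverse s ^ (2 * k + 1)) $ (2 * k)
      = (fps_X * ((s + fps_X * fps_deriv s) * inverse s ^ (2 * k - 1 + 1))) $ (2 * k)"
    by (rule arg_cong)
  also have "\<dots> = ((s + fps_X * fps_deriv s) * inverse s ^ (2 * k - 1 + 1)) $ (2 * k - 1)"
    using k by simp
  also have "\<dots> = 0"
    using k by (subst residue_derivative_power) (auto simp: s0)
  finally show ?thesis
    using d_coeff by (simp add: left_diff_distrib s_def d_def)
qed

theorem proposition2p5: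
  fixes k :: nat
  assumes "k > 0"
  shows "(\<Sum>j=0..2*k. (-1) ^ j * real (S3 (2 * (j + k)) j) / (2 ^ (j + k) * fact (j + k)))
       = (\<Sum>j=0..2*k. (-1) ^ j * real (d3 (2 * (j + k)) j) / (2 ^ (j + k) * fact (j + k)))"
proof -
  \<comment> \<open>\<open>L\<close> is \<open>g\<close>; \<open>Fs\<close> and \<open>Fd\<close> are \<open>2 f(x)/x^2\<close> and \<open>2 g(y)/y^2\<close>.\<close>
  define L :: "real fps" where "L = Abs_fps (\<lambda>n. if 2 \<le> n then 1 / real n else 0)"
  define Fs :: "real fps" where "Fs = Abs_fps (\<lambda>n. 2 / fact (n + 2))"
  define Fd :: "real fps" where "Fd = Abs_fps (\<lambda>n. 2 / real (n + 2))"
  have Fs0: "Fs $ 0 = 1" and Fd0: "Fd $ 0 = 1"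
    by (simp_all add: Fs_def Fd_def)
  have L': "(1 - fps_X) * fps_deriv L = fps_X"
  proof (rule fps_ext)
    fix n :: nat
    show "((1 - fps_X) * fps_deriv L) $ n = fps_X $ n"
      by (cases n) (auto simp: L_def left_diff_distrib)
  qed
  have Xs: "fps_X ^ 2 * Fs = fps_const 2 * (fps_exp 1 - 1 - fps_X)"
  proof (rule fps_ext)
    fix n :: nat
    define m where "m = n - 2"
    consider "n = 0" | "n = 1" | "n = m + 2" unfolding m_def by linarith
    then show "(fps_X ^ 2 * Fs) $ n = (fps_const 2 * (fps_exp 1 - 1 - fps_X)) $ n"
      by cases (simp_all add: Fs_def fps_X_power_mult_nth algebra_simps)
  qed
  have Xd: "fps_X ^ 2 * Fd = fps_const 2 * L"
    by (rule fps_ext) (simp add: Fd_def L_def fps_X_power_mult_nth)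

  define Gs where "Gs = Abs_fps (\<lambda>n. real (if 3 \<le> n then 1 else 0) / fact n)"
  define Gd where "Gd = Abs_fps (\<lambda>n. real (if 3 \<le> n then fact (n - 1) else 0) / fact n)"
  have Gs: "fps_const 2 * Gs = fps_X ^ 2 * (Fs - 1)"
  proof (rule fps_ext)
    fix n :: nat
    define m where "m = n - 3"
    consider "n < 2" | "n = 2" | "n = m + 3" unfolding m_def by linarith
    then show "(fps_const 2 * Gs) $ n = (fps_X ^ 2 * (Fs - 1)) $ n"
      by cases (simp_all add: Gs_def Fs_def fps_X_power_mult_nth
        numeral_3_eq_3 algebra_simps)
  qed
  have Gd: "fps_const 2 * Gd = fps_X ^ 2 * (Fd - 1)"
  proof (rule fps_ext)
    fix n :: nat
    define m where "m = n - 3"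
    consider "n < 2" | "n = 2" | "n = m + 3" unfolding m_def by linarith
    then show "(fps_const 2 * Gd) $ n = (fps_X ^ 2 * (Fd - 1)) $ n"
    proof cases
      case 3
      have "(fps_const 2 * Gd) $ n = 2 * (fact (m + 2) / fact (Suc (m + 2)))"
        using 3 by (simp add: Gd_def eval_nat_numeral del: fact_Suc)
      also have "fact (m + 2) / fact (Suc (m + 2)) = 1 / (real m + 3)"
        by (subst fact_Suc) (simp del: fact_Suc)
      also have "2 * (1 / (real m + 3)) = (fps_X ^ 2 * (Fd - 1)) $ n"
        using 3 by (simp add: Fd_def fps_X_power_mult_nth)
      finally show ?thesis .
    qed (simp_all add: Gd_def Fd_def fps_X_power_mult_nth)
  qed
  show ?thesis
    unfolding alternating_sum_eq_coeff[OF Fs0 Gs, of S3, OF S3_egf[folded Gs_def]]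
      alternating_sum_eq_coeff[OF Fd0 Gd, of d3, OF d3_egf[folded Gd_def]]
    using coeff_exp_eq_coeff_log[OF L' _ Xs Fs0 Xd Fd0 assms] by (simp add: L_def)
qed

end
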